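(* Let $0<q<1$, $\alpha>-1$, $c<0$, and let $T$ be the operator on pairs of non-negative sequences defined in the context. Let $a_n>0$ ($n\ge1$) be the recurrence coefficients of the orthonormal polynomials for the weight $w$ of the context, put $y_0=0$, $y_n=a_n^2q^{1-n}$ ($n\ge1$), and $\tilde u_n=y_{2n}$, $\tilde v_n=y_{2n+1}$ ($n\ge0$). Then: (i) $(\tilde u,\tilde v)$ is a fixed point of $T$. (ii) The sequence $\left(T^{2k}(0,0)\right)_{k\ge0}$ is termwise increasing and $\left(T^{2k+1}(0,0)\right)_{k\ge0}$ is termwise decreasing, and both converge termwise. Their respective limits $(\xi^-,\eta^-)$ and $(\xi^+,\eta^+)$ satisfy $T(\xi^-,\eta^-)=(\xi^+,\eta^+)$ and $T(\xi^+,\eta^+)=(\xi^-,\eta^-)$. (iii) Every fixed point $(\xi^*,\eta^* )$ of $T$ with non-negative components satisfies $(\xi^-,\eta^-)\le(\xi^*,\eta^* )\le(\xi^+,\eta^+)$ termwise. (iv) If $(\xi^-,\eta^-)=(\xi^+,\eta^+)$, then $T$ has only one fixed point with non-negative components, and it is $(\tilde u,\tilde v)$.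
   Context: $(a;q)_\infty=\prod_{j=0}^\infty(1-aq^j)$. The weight is $$w(x)=\frac{|x|^\alpha(q^2x^2;q^2)_\infty(cq^2x^2;q^2)_\infty}{(1-q^4)^{\alpha/4}}$$ on the lattice $L=\{\pm q^k:k=0,1,2,\ldots\}$; its orthonormal polynomials $p_n$ (degree $n$, positive leading coefficient) are determined by $\int_{-1}^1p_np_mw\,d_qx=\delta_{mn}$, where $\int_{-1}^1f(x)\,d_qx=(1-q)\sum_{k=0}^\infty f(q^k)q^k+(1-q)\sum_{k=0}^\infty f(-q^k)q^k$, and the recurrence coefficients $a_n>0$ are defined by $xp_n(x)=a_{n+1}p_{n+1}(x)+a_np_{n-1}(x)$, $n\ge0$, $p_{-1}=0$. Define $$f_n(x,y)=\frac{-x+\sqrt{x^2+4(1-q^{2n})y}}{2q^{-\alpha}y},\qquad g_n(x,y)=\frac{-x+\sqrt{x^2+4(1-q^{2n+1+\alpha})y}}{2y}.$$ For pairs of sequences $\xi=(\xi_0,\xi_1,\ldots)$, $\eta=(\eta_0,\eta_1,\ldots)$ of non-negative reals, $T(\xi,\eta)=(\xi',\eta')$ is given by $\xi'_0=0$, $$\xi'_n=f_n\left(-cq^{2n}(\eta_n+\eta_{n-1})+c+1,\;c^2q^{2n}\eta_n\eta_{n-1}-c\right)\quad(n>0),$$ $$\eta'_n=g_n\left(-cq^{2n+1}(\xi_n+\xi_{n+1})+c+1,\;c^2q^{2n+1-\alpha}\xi_n\xi_{n+1}-c\right)\quad(n\ge0).$$ Inequalities between pairs of sequences are termwise; monotonicity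 of sequences of such pairs is meant in the weak sense. *)

theory Defs
  imports
    "HOL-Analysis.Analysis"
    "HOL-Computational_Algebra.Polynomial"
begin

definition qpoch_inf :: "real \<Rightarrow> real \<Rightarrow> real" where
  "qpoch_inf a q = (\<Prod>j. 1 - a * q ^ j)"

definition weight :: "real \<Rightarrow> real \<Rightarrow> real \<Rightarrow> real \<Rightarrow> real" where
  "weight q \<alpha> c x =
     \<bar>x\<bar> powr \<alpha> * qpoch_inf (q^2 * x^2) (q^2) * qpoch_inf (c * q^2 * x^2) (q^2)
       / (1 - q^4) powr (\<alpha> / 4)"

text \<open>The Jackson integral over \<open>[-1, 1]\<close>.\<close>

definition jackson_integral :: "real \<Rightarrow> (real \<Rightarrow> real) \<Rightarrow> real" where
  "jackson_integral q f =
     (1 - q) * (\<Sum>k. f (q ^ k) * q ^ k) + (1 - q) * (\<Sum>k. f (- (q ^ k)) * q ^ k)"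

definition orthonormal_polys :: "real \<Rightarrow> real \<Rightarrow> real \<Rightarrow> (nat \<Rightarrow> real poly) \<Rightarrow> bool" where
  "orthonormal_polys q \<alpha> c p \<longleftrightarrow>
     (\<forall>n. degree (p n) = n \<and> lead_coeff (p n) > 0) \<and>
     (\<forall>n m. jackson_integral q (\<lambda>x. poly (p n) x * poly (p m) x * weight q \<alpha> c x)
              = (if m = n then 1 else 0))"

text \<open>The value \<open>a 0\<close> is irrelevant, since it only multiplies \<open>p\<^sub>-\<^sub>1 = 0\<close>.\<close>

definition recurrence_coeffs :: "(nat \<Rightarrow> real poly) \<Rightarrow> (nat \<Rightarrow> real) \<Rightarrow> bool" where
  "recurrence_coeffs p a \<longleftrightarrow>
     (\<forall>n\<ge>1. a n > 0) \<and>
     (\<forall>n. [:0, 1:] * p n =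
            smult (a (n + 1)) (p (n + 1)) + (if n = 0 then 0 else smult (a n) (p (n - 1))))"

type_synonym seq_pair = "(nat \<Rightarrow> real) \<times> (nat \<Rightarrow> real)"

definition f_fun :: "real \<Rightarrow> real \<Rightarrow> nat \<Rightarrow> real \<Rightarrow> real \<Rightarrow> real" where
  "f_fun q \<alpha> n x y =
     (- x + sqrt (x^2 + 4 * (1 - q ^ (2 * n)) * y)) / (2 * q powr (- \<alpha>) * y)"

definition g_fun :: "real \<Rightarrow> real \<Rightarrow> nat \<Rightarrow> real \<Rightarrow> real \<Rightarrow> real" where
  "g_fun q \<alpha> n x y =
     (- x + sqrt (x^2 + 4 * (1 - q powr (2 * real n + 1 + \<alpha>)) * y)) / (2 * y)"

definition T_op :: "real \<Rightarrow> real \<Rightarrow> real \<Rightarrow> seq_pair \<Rightarrow> seq_pair" where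
  "T_op q \<alpha> c = (\<lambda>(\<xi>, \<eta>).
     ((\<lambda>n. if n = 0 then 0
           else f_fun q \<alpha> n
                  (- c * q ^ (2 * n) * (\<eta> n + \<eta> (n - 1)) + c + 1)
                  (c^2 * q ^ (2 * n) * \<eta> n * \<eta> (n - 1) - c)),
      (\<lambda>n. g_fun q \<alpha> n
              (- c * q ^ (2 * n + 1) * (\<xi> n + \<xi> (n + 1)) + c + 1)
              (c^2 * q powr (2 * real n + 1 - \<alpha>) * \<xi> n * \<xi> (n + 1) - c))))"

definition zero_pair :: seq_pair where
  "zero_pair = (\<lambda>_. 0, \<lambda>_. 0)"

text \<open>On \<^typ>\<open>seq_pair\<close> the library order \<open>\<le>\<close> (products and functions, both componentwise)
  is the termwise order; in particular \<open>zero_pair \<le> z\<close> says that both sequences are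
  non-negative.\<close>

lemma seq_pair_le_iff:
  fixes z z' :: seq_pair
  shows "z \<le> z' \<longleftrightarrow> (\<forall>n. fst z n \<le> fst z' n) \<and> (\<forall>n. snd z n \<le> snd z' n)"
  by (auto simp: less_eq_prod_def le_fun_def)

definition converges_termwise :: "(nat \<Rightarrow> seq_pair) \<Rightarrow> seq_pair \<Rightarrow> bool" where
  "converges_termwise Z z \<longleftrightarrow>
     (\<forall>n. (\<lambda>k. fst (Z k) n) \<longlonglongrightarrow> fst z n) \<and> (\<forall>n. (\<lambda>k. snd (Z k) n) \<longlonglongrightarrow> snd z n)"

text \<open>\<open>T_op\<close> is given by its formula on all pairs of real sequences; for the parameters of
  interest it restricts to an operator on pairs of non-negative sequences.\<close>

lemma quadratic_root_nonneg:
  fixes x y k :: real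
  assumes "y > 0" "k \<ge> 0"
  shows "- x + sqrt (x^2 + 4 * k * y) \<ge> 0"
proof -
  have "x \<le> sqrt (x^2)" by simp
  also have "\<dots> \<le> sqrt (x^2 + 4 * k * y)" using assms by (intro real_sqrt_le_mono) simp
  finally show ?thesis by simp
qed

lemma T_op_nonneg:
  assumes "0 < q" "q < 1" "\<alpha> > -1" "c < 0" "zero_pair \<le> z"
  shows "zero_pair \<le> T_op q \<alpha> c z"
proof -
  obtain \<xi> \<eta> where z: "z = (\<xi>, \<eta>)" by (cases z)
  have nn: "\<xi> n \<ge> 0" "\<eta> n \<ge> 0" for n
    using assms(5) by (auto simp: z seq_pair_le_iff zero_pair_def)
  have y1: "c^2 * q ^ (2 * n) * \<eta> n * \<eta> (n - 1) - c > 0" for n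
  proof -
    have "c^2 * q ^ (2 * n) * \<eta> n * \<eta> (n - 1) \<ge> 0" using nn assms by simp
    then show ?thesis using \<open>c < 0\<close> by linarith
  qed
  have y2: "c^2 * q powr (2 * real n + 1 - \<alpha>) * \<xi> n * \<xi> (n + 1) - c > 0" for n
  proof -
    have "c^2 * q powr (2 * real n + 1 - \<alpha>) * \<xi> n * \<xi> (n + 1) \<ge> 0" using nn assms by simp
    then show ?thesis using \<open>c < 0\<close> by linarith
  qed
  have k1: "1 - q ^ (2 * n) \<ge> 0" for n using assms by (simp add: power_le_one)
  have k2: "1 - q powr (2 * real n + 1 + \<alpha>) \<ge> 0" for n
    using assms powr_mono'[of 0 "2 * real n + 1 + \<alpha>" q] by simp
  have "f_fun q \<alpha> n x (c^2 * q ^ (2 * n) * \<eta> n * \<eta> (n - 1) - c) \<ge> 0" for n x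
    unfolding f_fun_def using less_imp_le[OF y1]
    by (intro divide_nonneg_nonneg quadratic_root_nonneg[OF y1 k1] mult_nonneg_nonneg) auto
  moreover have "g_fun q \<alpha> n x (c^2 * q powr (2 * real n + 1 - \<alpha>) * \<xi> n * \<xi> (n + 1) - c) \<ge> 0" for n x
    unfolding g_fun_def using less_imp_le[OF y2]
    by (intro divide_nonneg_nonneg quadratic_root_nonneg[OF y2 k2] mult_nonneg_nonneg) auto
  ultimately show ?thesis
    unfolding seq_pair_le_iff z T_op_def zero_pair_def by simp
qed

end

theory Submission
  imports Defs
begin

text \<open>
  Two independent facts are combined: \<open>T\<close> is antitone and continuous on non-negative pairs, and the
  rescaled squared recurrence coefficients satisfy a nonlinear recurrence (a discrete Painleve
  equation) that says exactly that they form a fixed point of \<open>T\<close>.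

  Order part. The components of \<open>T\<close> are positive roots of quadratic equations
  \<open>Y * r\<^sup>2 + X * r = K\<close>, whose coefficients \<open>X\<close> and \<open>Y\<close> increase with the argument because
  \<open>c < 0\<close>; the root then decreases (\<open>T_antimono\<close>). So the even iterates of \<open>0\<close> increase, the odd
  ones decrease, all of them lie between \<open>0\<close> and \<open>T 0\<close>, and every non-negative fixed point is
  trapped between even and odd iterates (\<open>T_limits\<close>). If the two limits agree, nothing but one point
  is left, and this point is the fixed point known from the orthogonal polynomials.

  Fixed point part. The weight satisfies a Pearson equation, so that its functional \<open>L\<close> obeys
  \<open>L[(1 - x\<^sup>2) (1 - c x\<^sup>2) f(x)] = q powr (\<alpha> + 1) * L[f(q x)]\<close> (\<open>semiclassical_functional\<close>). It follows that
  \<open>(p n x - \<theta> n * p n (q x)) / x\<close>, where \<open>\<theta> n\<close> is \<open>1\<close> for even and \<open>q powr \<alpha>\<close> for odd \<open>n\<close>, involves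
  only \<open>p (n - 1)\<close> and \<open>p (n - 3)\<close>, with coefficients that are explicit in the \<open>a j\<close>
  (\<open>L_p_qdiff_Suc\<close>, \<open>L_p_qdiff_add3\<close>). Compatibility with the three-term recurrence gives a relation
  between four consecutive \<open>y j\<close> (\<open>y_relation\<close>). That relation has a first integral, which is
  therefore constant in \<open>n\<close> (\<open>first_integral_Suc\<close>); its value is found from the moments of order
  at most four (\<open>first_integral_1\<close>). The resulting equation is quadratic in \<open>y n\<close> and, \<open>y n\<close> being
  positive, identifies it as the root occurring in \<open>T\<close>.
\<close>

section \<open>The nonlinear recurrence for a semiclassical functional\<close>

text \<open>This lemma and the next one clear denominators in the compatibility relation below, first in
  terms of the recurrence coefficients and then in terms of the rescaled squares \<open>y\<close>.\<close>

lemma divide_by_product: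
  fixes A B C :: real
  assumes "A > 0" "B > 0" "t * (C * (K * (C * B * A)) + B * (R / A)) = u * (A * (S / B) - M * B * A * z)"
  shows "t * (K * C\<^sup>2 + R / A\<^sup>2) = u * (S / B\<^sup>2 - M * z)"
proof -
  have "A * B * (t * (K * C\<^sup>2 + R / A\<^sup>2)) = t * (C * (K * (C * B * A)) + B * (R / A))"
    using assms(1,2) by (simp add: field_simps power2_eq_square)
  also have "\<dots> = A * B * (u * (S / B\<^sup>2 - M * z))"
    unfolding assms(3) using assms(1,2) by (simp add: field_simps power2_eq_square)
  finally show ?thesis using assms(1,2) by simp
qed

lemma rescale_relation:
  fixes t :: real
  assumes pos: "t > 0" "s > 0" "q > 0" "P > 0"
    and eq: "t * (- c / P * (s / Q) * (P * q\<^sup>2 * Y3) + (1 - s * (q * P)) / (P * Y1))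
      = q * s * ((1 - t * (q\<^sup>2 * P)) / (P * q * Y2) - c * q / P * (t / Q) * (P / q * Y0))"
  shows "(1 / t - q\<^sup>2 * P) / Y2 + c * (q\<^sup>2 * P) / Q * Y3 = (1 / s - q * P) / Y1 + c * (q * P) / Q * Y0"
proof -
  have s: "1 - s * (q * P) = s * (1 / s - q * P)" and t: "1 - t * (q\<^sup>2 * P) = t * (1 / t - q\<^sup>2 * P)"
    using pos by (simp_all add: right_diff_distrib)
  define V W where "V = (1 / s - q * P) / Y1" and "W = (1 / t - q\<^sup>2 * P) / Y2"
  have "t * (- c / P * (s / Q) * (P * q\<^sup>2 * Y3) + s * N / (P * Y1)) = t * s / P * (N / Y1 - c * (q\<^sup>2 * P) / Q * Y3)" for N
    using pos by (simp add: right_diff_distrib distrib_left mult_ac)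
  note 1 = this[of "1 / s - q * P", folded s V_def]
  have "q * s * (t * N / (P * q * Y2) - c * q / P * (t / Q) * (P / q * Y0)) = t * s / P * (N / Y2 - c * (q * P) / Q * Y0)" for N
    using pos by (simp add: right_diff_distrib mult_ac)
  note 2 = this[of "1 / t - q\<^sup>2 * P", folded t W_def]
  have "t * s / P * (V - c * (q\<^sup>2 * P) / Q * Y3) = t * s / P * (W - c * (q * P) / Q * Y0)"
    using eq unfolding 1 2 .
  then have "V - c * (q\<^sup>2 * P) / Q * Y3 = W - c * (q * P) / Q * Y0" using pos by simp
  then show ?thesis unfolding V_def W_def by linarith
qed

text \<open>All that the nonlinear recurrence uses of the weight is that its integral is a linear
  functional satisfying the Pearson equation; \<open>Q\<close> stands for \<open>q powr \<alpha>\<close>. Evenness of the weight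
  enters only through the absence of a diagonal term in the three-term recurrence.\<close>

locale semiclassical =
  fixes q Q c :: real and L :: "real poly \<Rightarrow> real"
    and p :: "nat \<Rightarrow> real poly" and a :: "nat \<Rightarrow> real"
  assumes q_pos: "q > 0" and Q_pos: "Q > 0"
    and L_add: "L (f + g) = L f + L g"
    and L_smult: "L (smult r f) = r * L f"
    and pearson: "L ([:1, 0, - (1 + c), 0, c:] * f) = q * Q * L (f \<circ>\<^sub>p [:0, q:])"
    and degree_p: "degree (p n) = n"
    and lead_pos: "lead_coeff (p n) > 0"
    and orth: "L (p n * p m) = (if m = n then 1 else 0)"
    and a_pos: "n \<ge> 1 \<Longrightarrow> a n > 0"
    and recurrence: "[:0, 1:] * p n =
      smult (a (n + 1)) (p (n + 1)) + (if n = 0 then 0 else smult (a n) (p (n - 1)))"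
begin

abbreviation (input) "\<gamma> n \<equiv> coeff (p n) n"
abbreviation (input) "\<sigma> \<equiv> [:1, 0, - (1 + c), 0, c:]"

text \<open>For odd \<open>n\<close> the quotient \<open>(p n x - t * p n (q * x)) / x\<close> has to be paired also with polynomials
  \<open>h\<close> that do not vanish at \<open>0\<close>; the Pearson equation removes the contribution of \<open>h 0 / x\<close>
  only for \<open>t = Q\<close>.\<close>

definition \<theta> :: "nat \<Rightarrow> real" where "\<theta> n = (if even n then 1 else Q)"

lemma theta_pos: "\<theta> n > 0" by (simp add: \<theta>_def Q_pos)

lemma theta_add3: "\<theta> (n + 3) = \<theta> (n + 1)" by (simp add: \<theta>_def)

lemma gamma_pos: "\<gamma> n > 0" using lead_pos[of n] by (simp add: degree_p)

lemma coeff_p_eq_0: "i > n \<Longrightarrow> coeff (p n) i = 0" by (simp add: coeff_eq_0 degree_p)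

lemma L_0: "L 0 = 0" using L_smult[of 0 0] by simp

lemma L_diff: "L (f - g) = L f - L g"
  using L_add[of f "smult (-1) g"] L_smult[of "-1" g] by simp

text \<open>Each \<open>p k\<close> has degree exactly \<open>k\<close>, so the leading term of \<open>g\<close> can be removed by
  subtracting a multiple of some \<open>p k\<close> that is orthogonal to \<open>p n\<close>.\<close>

lemma L_p_mult_eq_0:
  assumes "\<And>i. i \<ge> k \<Longrightarrow> coeff g i = 0" "k \<le> n"
  shows "L (p n * g) = 0"
  using assms
proof (induction k arbitrary: g)
  case 0
  then have "g = 0" by (intro poly_eqI) simp
  then show ?case by (simp add: L_0)
next
  case (Suc k)
  define g' where "g' = g - smult (coeff g k / \<gamma> k) (p k)"
  have "coeff g' i = 0" if "i \<ge> k" for i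
    using that gamma_pos[of k] Suc.prems(1)[of i]
    by (cases "i = k") (auto simp: g'_def coeff_p_eq_0)
  then have "L (p n * g') = 0" using Suc by (intro Suc.IH) auto
  moreover have "p n * g = p n * g' + smult (coeff g k / \<gamma> k) (p n * p k)"
    by (simp add: g'_def algebra_simps)
  ultimately show ?case using Suc.prems(2) by (simp add: L_add L_smult orth)
qed

lemma L_p_mult:
  assumes "\<And>i. i > n \<Longrightarrow> coeff g i = 0"
  shows "L (p n * g) = coeff g n / \<gamma> n"
proof -
  define g' where "g' = g - smult (coeff g n / \<gamma> n) (p n)"
  have "coeff g' i = 0" if "i \<ge> n" for i
    using that gamma_pos[of n] assms[of i]
    by (cases "i = n") (auto simp: g'_def coeff_p_eq_0)
  then have "L (p n * g') = 0" by (intro L_p_mult_eq_0) auto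
  moreover have "p n * g = p n * g' + smult (coeff g n / \<gamma> n) (p n * p n)"
    by (simp add: g'_def algebra_simps)
  ultimately show ?thesis by (simp add: L_add L_smult orth)
qed

lemma gamma_Suc: "\<gamma> n = a (Suc n) * \<gamma> (Suc n)"
proof -
  have "coeff ([:0, 1:] * p n) (Suc n) = a (Suc n) * \<gamma> (Suc n)"
    unfolding recurrence by (simp add: coeff_p_eq_0)
  then show ?thesis by simp
qed

lemma p_odd_0: "odd n \<Longrightarrow> coeff (p n) 0 = 0"
proof (induction n rule: less_induct)
  case (less n)
  then obtain m where n: "n = Suc m" by (cases n) auto
  have "0 = coeff ([:0, 1:] * p m) 0" by simp
  also have "\<dots> = a n * coeff (p n) 0" 
    unfolding recurrence using less by (auto simp: n)
  finally show ?case using a_pos[of n] n by simp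
qed

text \<open>The twisted \<open>q\<close>-difference quotient \<open>(p n x - \<theta> n * p n (q * x)) / x\<close>. It is a polynomial: for
  even \<open>n\<close> because \<open>\<theta> n = 1\<close>, for odd \<open>n\<close> because \<open>p n\<close> vanishes at \<open>0\<close>.\<close>

definition qdiff :: "nat \<Rightarrow> real poly" where
  "qdiff n = poly_shift 1 (p n - smult (\<theta> n) (p n \<circ>\<^sub>p [:0, q:]))"

lemma pCons_poly_shift: "coeff g 0 = 0 \<Longrightarrow> pCons 0 (poly_shift 1 g) = g"
  by (rule poly_eqI) (simp add: coeff_pCons coeff_poly_shift split: nat.split)

lemma coeff_qdiff: "coeff (qdiff n) i = (1 - \<theta> n * q ^ Suc i) * coeff (p n) (Suc i)"
  by (simp add: qdiff_def coeff_poly_shift coeff_pcompose_linear algebra_simps)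

lemma pCons_qdiff: "pCons 0 (qdiff n) = p n - smult (\<theta> n) (p n \<circ>\<^sub>p [:0, q:])"
  unfolding qdiff_def using p_odd_0[of n]
  by (intro pCons_poly_shift) (auto simp: \<theta>_def coeff_pcompose_linear poly_0_coeff_0)

lemma poly_qdiff: "x * poly (qdiff n) x = poly (p n) x - \<theta> n * poly (p n) (q * x)"
proof -
  have "poly (pCons 0 (qdiff n)) x = poly (p n) x - \<theta> n * poly (p n) (q * x)"
    unfolding pCons_qdiff by (simp add: poly_pcompose mult.commute)
  then show ?thesis by simp
qed

lemma L_p_qdiff_Suc: "L (p m * qdiff (Suc m)) = (1 - \<theta> (Suc m) * q ^ Suc m) / a (Suc m)"
proof -
  have "L (p m * qdiff (Suc m)) = coeff (qdiff (Suc m)) m / \<gamma> m"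
    by (rule L_p_mult) (simp add: coeff_qdiff coeff_p_eq_0)
  also have "\<dots> = (1 - \<theta> (Suc m) * q ^ Suc m) / a (Suc m)"
    using gamma_pos[of "Suc m"] a_pos[of "Suc m"] by (simp add: coeff_qdiff gamma_Suc[of m] field_simps)
  finally show ?thesis .
qed

lemma coeff_sigma_mult:
  "coeff (\<sigma> * g) (k + 4) = coeff g (k + 4) - (1 + c) * coeff g (k + 2) + c * coeff g k"
proof -
  have k: "k + 4 = Suc (Suc (Suc (Suc k)))" "k + 2 = Suc (Suc k)" by simp_all
  show ?thesis unfolding k by (simp add: mult_pCons_left algebra_simps)
qed

lemma dilate_dilate: "(g \<circ>\<^sub>p [:0, 1 / q:]) \<circ>\<^sub>p [:0, q:] = g"
  using q_pos by (intro poly_eqI) (simp add: coeff_pcompose_linear power_divide)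

text \<open>The Pearson equation moves a dilation from one factor to the other, at the cost of the
  quartic \<open>\<sigma>\<close>.\<close>

lemma pearson_dual: "q * Q * L ((f \<circ>\<^sub>p [:0, q:]) * g) = L (\<sigma> * (f * (g \<circ>\<^sub>p [:0, 1 / q:])))"
  unfolding pearson by (simp add: pcompose_mult dilate_dilate)

text \<open>By the Pearson equation \<open>qdiff n\<close> is a combination of \<open>p (n - 1)\<close> and \<open>p (n - 3)\<close> only; the
  first coefficient is read off from the leading terms (\<open>L_p_qdiff_Suc\<close>), and this lemma gives
  the second. One factor \<open>x\<close> is split off from whichever of \<open>p m\<close> and \<open>p (m + 3)\<close> has odd
  index, which turns the difference quotient into a difference of dilates. After dualizing, the
  answer comes from the leading coefficient \<open>c\<close> of \<open>\<sigma>\<close>, since all lower terms are orthogonal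
  to \<open>p (m + 3)\<close>.\<close>

lemma L_p_qdiff_add3:
  "L (p m * qdiff (m + 3)) = - c / q ^ m * (\<theta> (m + 3) / Q) * (a (m + 3) * a (m + 2) * a (m + 1))"
proof -
  have ratio: "\<gamma> m / \<gamma> (m + 3) = a (m + 3) * a (m + 2) * a (m + 1)"
  proof -
    have "\<gamma> m = a (m + 3) * a (m + 2) * a (m + 1) * \<gamma> (m + 3)"
      using gamma_Suc[of m] gamma_Suc[of "m + 1"] gamma_Suc[of "m + 2"] by (simp add: eval_nat_numeral)
    then show ?thesis using gamma_pos[of "m + 3"] by simp
  qed
  have "L (p m * qdiff (m + 3)) = - c / q ^ m * (\<theta> (m + 3) / Q) * (\<gamma> m / \<gamma> (m + 3))"
  proof (cases "even m")
    case False
    define s where "s = poly_shift 1 (p m)"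
    define h where "h = s \<circ>\<^sub>p [:0, 1 / q:]"
    have s: "pCons 0 s = p m" unfolding s_def using False by (intro pCons_poly_shift p_odd_0)
    have cs: "coeff h i = (1 / q) ^ i * coeff (p m) (Suc i)" for i
      by (simp add: h_def s_def coeff_pcompose_linear coeff_poly_shift)
    have [simp]: "\<theta> (m + 3) = 1" using False by (simp add: \<theta>_def)
    have "p m * qdiff (m + 3) = pCons 0 (qdiff (m + 3)) * s" unfolding s[symmetric] by (simp add: mult.commute)
    also have "\<dots> = p (m + 3) * s - (p (m + 3) \<circ>\<^sub>p [:0, q:]) * s"
      unfolding pCons_qdiff by (simp add: algebra_simps)
    finally have "L (p m * qdiff (m + 3)) = L (p (m + 3) * s) - L ((p (m + 3) \<circ>\<^sub>p [:0, q:]) * s)"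
      by (simp add: L_diff)
    moreover have "L (p (m + 3) * s) = 0"
      by (rule L_p_mult_eq_0[of m]) (auto simp: s_def coeff_poly_shift coeff_p_eq_0)
    moreover have "q * Q * L ((p (m + 3) \<circ>\<^sub>p [:0, q:]) * s) = L (p (m + 3) * (\<sigma> * h))"
      unfolding pearson_dual h_def by (simp only: mult.left_commute)
    moreover have "L (p (m + 3) * (\<sigma> * h)) = c * (1 / q) ^ (m - 1) * (\<gamma> m / \<gamma> (m + 3))"
    proof -
      have m: "m + 3 = (m - 1) + 4" "Suc (m - 1) = m" using False by (auto elim: oddE)
      have "coeff (\<sigma> * h) i = 0" if "i > m + 3" for i
      proof -
        obtain j where "i = j + 4" "j \<ge> m" using \<open>i > m + 3\<close> by (intro that[of "i - 4"]) auto
        then show ?thesis by (simp only: coeff_sigma_mult) (simp add: cs coeff_p_eq_0)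
      qed
      then have "L (p (m + 3) * (\<sigma> * h)) = coeff (\<sigma> * h) (m + 3) / \<gamma> (m + 3)" by (rule L_p_mult)
      also have "coeff (\<sigma> * h) (m + 3) = c * coeff h (m - 1)"
        unfolding m(1) coeff_sigma_mult by (simp add: cs coeff_p_eq_0)
      also have "coeff h (m - 1) = (1 / q) ^ (m - 1) * \<gamma> m" by (simp only: cs m(2))
      finally show ?thesis by simp
    qed
    moreover have "(1 / q) ^ (m - 1) = q / q ^ m"
      using False q_pos by (cases m) (auto simp: field_simps)
    ultimately have "L (p m * qdiff (m + 3)) = - L ((p (m + 3) \<circ>\<^sub>p [:0, q:]) * s)"
      "q * Q * L ((p (m + 3) \<circ>\<^sub>p [:0, q:]) * s) = c * (q / q ^ m) * (\<gamma> m / \<gamma> (m + 3))"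
      by simp_all
    note 1 = this
    have "L ((p (m + 3) \<circ>\<^sub>p [:0, q:]) * s) = c * (q / q ^ m) * (\<gamma> m / \<gamma> (m + 3)) / (q * Q)"
      unfolding 1(2)[symmetric] using q_pos Q_pos by simp
    then have "L (p m * qdiff (m + 3)) = - (c * (q / q ^ m) * (\<gamma> m / \<gamma> (m + 3)) / (q * Q))"
      using 1(1) by simp
    then show ?thesis using q_pos by simp
  next
    case True
    define r where "r = poly_shift 1 (p (m + 3))"
    define h where "h = p m \<circ>\<^sub>p [:0, 1 / q:]"
    define k where "k = poly_shift 1 (p m - \<sigma> * h)"
    have ch: "coeff h i = (1 / q) ^ i * coeff (p m) i" for i
      by (simp add: h_def coeff_pcompose_linear)
    have r: "pCons 0 r = p (m + 3)" unfolding r_def using True by (intro pCons_poly_shift p_odd_0) auto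
    have [simp]: "\<theta> (m + 3) = Q" using True by (simp add: \<theta>_def)
    have "pCons 0 (qdiff (m + 3)) = pCons 0 (r - smult (q * Q) (r \<circ>\<^sub>p [:0, q:]))"
      unfolding pCons_qdiff r[symmetric] by (simp add: pcompose_pCons mult.commute)
    then have "qdiff (m + 3) = r - smult (q * Q) (r \<circ>\<^sub>p [:0, q:])" by simp
    then have "p m * qdiff (m + 3) = r * p m - smult (q * Q) ((r \<circ>\<^sub>p [:0, q:]) * p m)"
      by (simp only: right_diff_distrib mult_smult_right mult.commute[of "p m"])
    then have "L (p m * qdiff (m + 3)) = L (r * p m) - q * Q * L ((r \<circ>\<^sub>p [:0, q:]) * p m)"
      by (simp only: L_diff L_smult)
    also have "\<dots> = L (r * p m) - L (\<sigma> * (r * h))"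
      unfolding pearson_dual h_def ..
    also have "\<dots> = L (r * (p m - \<sigma> * h))"
      unfolding L_diff[symmetric] by (simp only: right_diff_distrib mult.left_commute)
    also have "p m - \<sigma> * h = pCons 0 k" 
      unfolding k_def by (rule pCons_poly_shift[symmetric]) (simp add: ch)
    also have "r * pCons 0 k = p (m + 3) * k" unfolding r[symmetric] by simp
    also have "L (p (m + 3) * k) = coeff k (m + 3) / \<gamma> (m + 3)"
    proof (rule L_p_mult)
      fix i assume "i > m + 3"
      then obtain j where j: "Suc i = j + 4" "j > m" by (intro that[of "i - 3"]) auto
      show "coeff k i = 0" 
      proof -
        have "coeff k i = coeff (p m - \<sigma> * h) (j + 4)"
          using j(1) by (simp only: k_def coeff_poly_shift Suc_eq_plus1)
        then show ?thesis using j(2)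
          by (simp only: coeff_diff coeff_sigma_mult) (simp add: ch coeff_p_eq_0)
      qed
    qed
    also have "coeff k (m + 3) = - c / q ^ m * \<gamma> m"
    proof -
      have "coeff k (m + 3) = coeff (p m - \<sigma> * h) (m + 4)" by (simp add: k_def coeff_poly_shift eval_nat_numeral del: mult_pCons_left)
      also have "\<dots> = - c / q ^ m * \<gamma> m"
        unfolding coeff_diff coeff_sigma_mult by (simp add: ch coeff_p_eq_0 power_divide)
      finally show ?thesis .
    qed
    finally show ?thesis using Q_pos by simp
  qed
  then show ?thesis unfolding ratio .
qed

lemma poly_recurrence:
  "n \<ge> 1 \<Longrightarrow> x * poly (p n) x = a (n + 1) * poly (p (n + 1)) x + a n * poly (p (n - 1)) x"
  using arg_cong[OF recurrence[of n], of "\<lambda>g. poly g x"] by simp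

text \<open>Compatibility of the \<open>q\<close>-difference quotient with the three-term recurrence: \<open>p (k + 3)\<close> and
  \<open>p (k + 1)\<close> carry the same twist \<open>\<theta>\<close>, so the recurrence at \<open>x\<close> and at \<open>q * x\<close> can be
  subtracted.\<close>

lemma qdiff_compatible:
  "smult (\<theta> (k + 2)) (smult (a (k + 3)) (qdiff (k + 3)) + smult (a (k + 2)) (qdiff (k + 1)))
     = smult (q * \<theta> (k + 1)) (pCons 0 (qdiff (k + 2))) + smult (\<theta> (k + 2) - q * \<theta> (k + 1)) (p (k + 2))"
  (is "?l = ?r")
proof -
  have "x * poly ?l x = x * poly ?r x" for x
  proof -
    note th = theta_add3[of k]
    have r1: "x * poly (p (k + 2)) x = a (k + 3) * poly (p (k + 3)) x + a (k + 2) * poly (p (k + 1)) x" for x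
      using poly_recurrence[of "k + 2" x] by (simp add: eval_nat_numeral)
    have "x * poly ?l x = \<theta> (k + 2) * (a (k + 3) * (x * poly (qdiff (k + 3)) x) + a (k + 2) * (x * poly (qdiff (k + 1)) x))"
      by (simp add: algebra_simps)
    also have "\<dots> = \<theta> (k + 2) * ((a (k + 3) * poly (p (k + 3)) x + a (k + 2) * poly (p (k + 1)) x)
        - \<theta> (k + 1) * (a (k + 3) * poly (p (k + 3)) (q * x) + a (k + 2) * poly (p (k + 1)) (q * x)))"
      unfolding poly_qdiff th by (simp add: algebra_simps)
    also have "\<dots> = \<theta> (k + 2) * (x * poly (p (k + 2)) x - \<theta> (k + 1) * (q * x * poly (p (k + 2)) (q * x)))"
      unfolding r1 ..
    also have "\<dots> = q * \<theta> (k + 1) * x * (poly (p (k + 2)) x - \<theta> (k + 2) * poly (p (k + 2)) (q * x))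
        + x * ((\<theta> (k + 2) - q * \<theta> (k + 1)) * poly (p (k + 2)) x)"
      by (simp add: algebra_simps)
    also have "\<dots> = x * poly ?r x"
      unfolding poly_qdiff[symmetric] by (simp add: algebra_simps)
    finally show ?thesis .
  qed
  then have "poly ([:0, 1:] * ?l) = poly ([:0, 1:] * ?r)" by (intro ext) simp
  then have "[:0, 1:] * ?l = [:0, 1:] * ?r" by (simp only: poly_eq_poly_eq_iff)
  then show ?thesis by simp
qed

definition y :: "nat \<Rightarrow> real" where "y n = (if n = 0 then 0 else (a n)\<^sup>2 / q ^ (n - 1))"

lemma y_pos: "n \<ge> 1 \<Longrightarrow> y n > 0"
  using a_pos[of n] q_pos by (simp add: y_def)

text \<open>This is the compatibility identity paired with \<open>p k\<close>, which kills the term with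
  \<open>p (k + 2)\<close>. For \<open>k = 0\<close> there is no \<open>p (k - 1)\<close>; this is what the convention \<open>y 0 = 0\<close>
  encodes.\<close>

lemma y_relation:
  "(1 / \<theta> (k + 2) - q ^ (k + 2)) / y (k + 2) + c * q ^ (k + 2) / Q * y (k + 3)
    = (1 / \<theta> (k + 1) - q ^ (k + 1)) / y (k + 1) + c * q ^ (k + 1) / Q * y k"
proof -
  define t s where "t = \<theta> (k + 2)" and "s = \<theta> (k + 1)"
  have ts: "\<theta> (k + 3) = s" "t > 0" "s > 0"
    using theta_add3[of k] theta_pos by (auto simp: t_def s_def)
  define z where "z = (if k = 0 then 0 else (a k)\<^sup>2)"
  have a: "a (k + 1) > 0" "a (k + 2) > 0" "a (k + 3) > 0" by (auto intro!: a_pos)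
  have 1: "L (p k * qdiff (k + 1)) = (1 - s * q ^ (k + 1)) / a (k + 1)"
    using L_p_qdiff_Suc[of k] by (simp add: s_def)
  have 2: "L (p k * pCons 0 (qdiff (k + 2))) = a (k + 1) * ((1 - t * q ^ (k + 2)) / a (k + 2))
      - c * q / q ^ k * (t / Q) * a (k + 2) * a (k + 1) * z"
  proof -
    have "L (p k * pCons 0 (qdiff (k + 2))) = L (([:0, 1:] * p k) * qdiff (k + 2))"
      by simp
    also have "\<dots> = a (k + 1) * L (p (k + 1) * qdiff (k + 2)) + (if k = 0 then 0 else a k * L (p (k - 1) * qdiff (k + 2)))"
      unfolding recurrence by (simp add: algebra_simps L_add L_smult L_0)
    also have "L (p (k + 1) * qdiff (k + 2)) = (1 - t * q ^ (k + 2)) / a (k + 2)"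
      using L_p_qdiff_Suc[of "k + 1"] by (simp add: t_def)
    also have "(if k = 0 then 0 else a k * L (p (k - 1) * qdiff (k + 2)))
        = - c * q / q ^ k * (t / Q) * a (k + 2) * a (k + 1) * z"
    proof (cases k)
      case (Suc j)
      then have k: "k - 1 = j" "k + 2 = j + 3" "k + 1 = j + 2" "k = j + 1" "k \<noteq> 0" by simp_all
      have "a k * L (p (k - 1) * qdiff (k + 2))
          = a k * (- c / q ^ j * (t / Q) * (a (k + 2) * a (k + 1) * a k))"
        unfolding t_def k(1-3) L_p_qdiff_add3 unfolding k(4) ..
      also have "\<dots> = - (c / q ^ j) * (t / Q) * a (k + 2) * a (k + 1) * (a k)\<^sup>2"
        by (simp only: power2_eq_square mult_ac minus_divide_left)
      also have "c / q ^ j = c * q / q ^ k" using q_pos by (simp add: k(4))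
      finally show ?thesis using k(5) by (simp add: z_def)
    qed (simp add: z_def)
    finally show ?thesis by simp
  qed
  have 3: "L (p k * p (k + 2)) = 0" by (simp add: orth)
  have "t * (a (k + 3) * L (p k * qdiff (k + 3)) + a (k + 2) * L (p k * qdiff (k + 1)))
      = q * s * L (p k * pCons 0 (qdiff (k + 2)))"
    using arg_cong[OF qdiff_compatible[of k], of "\<lambda>g. L (p k * g)"]
    by (simp only: distrib_left mult_smult_right L_add L_smult 3 t_def s_def mult_zero_right add_0_right mult.assoc)
  then have "t * (a (k + 3) * (- c / q ^ k * (s / Q) * (a (k + 3) * a (k + 2) * a (k + 1)))
        + a (k + 2) * ((1 - s * q ^ (k + 1)) / a (k + 1)))
      = q * s * (a (k + 1) * ((1 - t * q ^ (k + 2)) / a (k + 2))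
      - c * q / q ^ k * (t / Q) * a (k + 2) * a (k + 1) * z)"
    unfolding 1 2 L_p_qdiff_add3 ts(1) .
  then have "t * (- c / q ^ k * (s / Q) * (a (k + 3))\<^sup>2 + (1 - s * q ^ (k + 1)) / (a (k + 1))\<^sup>2)
      = q * s * ((1 - t * q ^ (k + 2)) / (a (k + 2))\<^sup>2 - c * q / q ^ k * (t / Q) * z)"
    by (intro divide_by_product a)
  moreover have "z = q ^ k / q * y k"
    using q_pos by (cases k) (simp_all add: z_def y_def)
  moreover have "(a (k + 1))\<^sup>2 = q ^ k * y (k + 1)" "(a (k + 2))\<^sup>2 = q ^ k * q * y (k + 2)" "(a (k + 3))\<^sup>2 = q ^ k * q\<^sup>2 * y (k + 3)"
    using q_pos by (simp_all add: y_def power2_eq_square numeral_3_eq_3)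
  moreover have q_powers: "q ^ (k + 1) = q * q ^ k" "q ^ (k + 2) = q\<^sup>2 * q ^ k"
    by (simp_all add: power2_eq_square)
  ultimately have "t * (- c / q ^ k * (s / Q) * (q ^ k * q\<^sup>2 * y (k + 3)) + (1 - s * (q * q ^ k)) / (q ^ k * y (k + 1)))
      = q * s * ((1 - t * (q\<^sup>2 * q ^ k)) / (q ^ k * q * y (k + 2)) - c * q / q ^ k * (t / Q) * (q ^ k / q * y k))"
    by (simp only:)
  from rescale_relation[OF ts(2,3) q_pos _ this] show ?thesis
    unfolding t_def[symmetric] s_def[symmetric] q_powers using q_pos by simp
qed

text \<open>The relation above is one order higher than the wanted recurrence; this quantity sums it,
  because the difference of its consecutive values is a multiple of the difference of the two
  sides of the relation.\<close>

definition first_integral :: "nat \<Rightarrow> real" where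
  "first_integral n = (q ^ n - 1 / \<theta> n) / y n - c * q ^ n / Q * (y (n - 1) + y (n + 1))
     + c\<^sup>2 * q ^ n / Q\<^sup>2 * y (n - 1) * y n * y (n + 1) - c / Q / \<theta> (n + 1) * y n"

lemma first_integral_Suc: "first_integral (k + 2) = first_integral (k + 1)"
proof -
  define m n where "m = 1 / \<theta> (k + 2)" and "n = 1 / \<theta> (k + 1)"
  have th: "1 / \<theta> (k + 3) = n" by (simp add: n_def theta_add3)
  define X where "X = (m - q ^ (k + 2)) / y (k + 2) + c * q ^ (k + 2) / Q * y (k + 3)"
  define Y where "Y = (n - q ^ (k + 1)) / y (k + 1) + c * q ^ (k + 1) / Q * y k"
  have XY: "X = Y" using y_relation[of k] by (simp add: X_def Y_def m_def n_def)
  have pos: "y (k + 1) > 0" "y (k + 2) > 0" by (auto intro: y_pos)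
  have EX: "first_integral (k + 2) = - X - c * q ^ (k + 2) / Q * y (k + 1)
      + c\<^sup>2 * q ^ (k + 2) / Q\<^sup>2 * y (k + 1) * y (k + 2) * y (k + 3) - c / Q * n * y (k + 2)"
  proof -
    have "k + 2 - 1 = k + 1" "k + 2 + 1 = k + 3" by simp_all
    then show ?thesis unfolding first_integral_def X_def m_def th[symmetric]
      by (simp add: diff_divide_distrib algebra_simps eval_nat_numeral)
  qed
  have EY: "first_integral (k + 1) = - Y - c * q ^ (k + 1) / Q * y (k + 2)
      + c\<^sup>2 * q ^ (k + 1) / Q\<^sup>2 * y k * y (k + 1) * y (k + 2) - c / Q * m * y (k + 1)"
  proof -
    have "k + 1 - 1 = k" "k + 1 + 1 = k + 2" by simp_all
    then show ?thesis unfolding first_integral_def Y_def m_def n_def by (simp add: diff_divide_distrib algebra_simps)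
  qed
  have "first_integral (k + 2) - first_integral (k + 1) = Y - X + c / Q * y (k + 1) * y (k + 2) * (X - Y)"
    unfolding EX EY using pos Q_pos unfolding X_def Y_def
    by (simp add: field_simps power2_eq_square)
  then show ?thesis using XY by simp
qed

text \<open>The constant of summation comes from the Pearson equation for the square of the constant
  polynomial \<open>p 0\<close>, whose moments up to order four are expressible by \<open>a 1\<close> and \<open>a 2\<close>.\<close>

lemma first_integral_1: "first_integral 1 = - ((1 + c) / Q)"
proof -
  have xp0: "[:0, 1:] * p 0 = smult (a 1) (p 1)" using recurrence[of 0] by simp
  have "[:0, 1:] * p 1 = smult (a 2) (p 2) + smult (a 1) (p 0)" using recurrence[of 1] by (simp add: numeral_2_eq_2)
  then have xxp0: "[:0, 1:] * ([:0, 1:] * p 0) = smult (a 1) (smult (a 2) (p 2) + smult (a 1) (p 0))"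
    unfolding xp0 by (simp only: mult_smult_right)
  have "L (\<sigma> * (p 0 * p 0)) = q * Q * L ((p 0 * p 0) \<circ>\<^sub>p [:0, q:])" by (rule pearson)
  also have "(p 0 * p 0) \<circ>\<^sub>p [:0, q:] = p 0 * p 0"
    using degree_p[of 0] by (auto elim!: degree_eq_zeroE simp: pcompose_mult)
  also have "\<sigma> * (p 0 * p 0) = p 0 * p 0 - smult (1 + c) (([:0, 1:] * p 0) * ([:0, 1:] * p 0))
      + smult c (([:0, 1:] * ([:0, 1:] * p 0)) * ([:0, 1:] * ([:0, 1:] * p 0)))"
    by (rule poly_eqI) (auto simp: poly_eq_poly_eq_iff[symmetric] algebra_simps coeff_pCons split: nat.splits)
  finally have "1 - (1 + c) * L (([:0, 1:] * p 0) * ([:0, 1:] * p 0))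
      + c * L (([:0, 1:] * ([:0, 1:] * p 0)) * ([:0, 1:] * ([:0, 1:] * p 0))) = q * Q"
    by (simp only: L_add L_diff L_smult orth) simp
  moreover have "L (([:0, 1:] * p 0) * ([:0, 1:] * p 0)) = (a 1)\<^sup>2"
    unfolding xp0 by (simp add: L_smult orth power2_eq_square)
  moreover have "L (([:0, 1:] * ([:0, 1:] * p 0)) * ([:0, 1:] * ([:0, 1:] * p 0)))
      = (a 1)\<^sup>2 * ((a 2)\<^sup>2 + (a 1)\<^sup>2)"
    unfolding xxp0
    by (simp add: distrib_left distrib_right smult_add_right L_add L_smult orth power2_eq_square)
  ultimately have "1 - (1 + c) * (a 1)\<^sup>2 + c * ((a 1)\<^sup>2 * ((a 2)\<^sup>2 + (a 1)\<^sup>2)) = q * Q"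
    by simp
  moreover have "(a 1)\<^sup>2 = y 1" "(a 2)\<^sup>2 = q * y 2" using q_pos by (auto simp: y_def)
  ultimately have "1 - (1 + c) * y 1 + c * (y 1 * (q * y 2 + y 1)) = q * Q" by simp
  then have "q * Q - 1 - c * q * y 1 * y 2 - c * (y 1)\<^sup>2 + (1 + c) * y 1 = 0"
    by (simp add: algebra_simps power2_eq_square)
  moreover have "first_integral 1 = (q * Q - 1 - c * q * y 1 * y 2 - c * (y 1)\<^sup>2 + (1 + c) * y 1) / (Q * y 1) - (1 + c) / Q"
  proof -
    have "first_integral 1 = (q - 1 / Q) / y 1 - c * q / Q * y 2 - c / Q * y 1"
      by (simp add: first_integral_def \<theta>_def y_def[of 0] numeral_2_eq_2)
    also have "\<dots> = (q * Q - 1 - c * q * Y * y 2 - c * Y\<^sup>2 + (1 + c) * Y) / (Q * Y) - (1 + c) / Q"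
      if "Y = y 1" for Y
      using y_pos[of 1, folded that] Q_pos unfolding that[symmetric]
      by (simp add: field_simps power2_eq_square)
    finally show ?thesis by simp
  qed
  ultimately show ?thesis by simp
qed

lemma first_integral_const: "n \<ge> 1 \<Longrightarrow> first_integral n = - ((1 + c) / Q)"
proof (induction n rule: dec_induct)
  case (step n)
  then show ?case using first_integral_Suc[of "n - 1"] by simp
qed (use first_integral_1 in simp)

text \<open>Cleared of denominators, the constancy of the first integral is a quadratic equation for
  \<open>y n\<close> whose coefficients depend on \<open>y (n - 1)\<close> and \<open>y (n + 1)\<close>; the parity of \<open>n\<close> decides
  where the powers of \<open>Q\<close> go.\<close>

lemma painleve_even:
  assumes "n \<ge> 1"
  shows "(c\<^sup>2 * q ^ (2 * n) * y (2 * n + 1) * y (2 * n - 1) - c) * (y (2 * n) / Q)\<^sup>2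
      + (- c * q ^ (2 * n) * (y (2 * n + 1) + y (2 * n - 1)) + c + 1) * (y (2 * n) / Q) = 1 - q ^ (2 * n)"
proof -
  define P u A B where "P = q ^ (2 * n)" and "u = y (2 * n)" and "A = y (2 * n - 1)" and "B = y (2 * n + 1)"
  have "u > 0" unfolding u_def using assms by (intro y_pos) simp
  have "(P - 1) / u - c * P / Q * (A + B) + c\<^sup>2 * P / Q\<^sup>2 * A * u * B - c / Q / Q * u = - ((1 + c) / Q)"
    using first_integral_const[of "2 * n"] assms unfolding first_integral_def P_def u_def A_def B_def by (simp add: \<theta>_def)
  then have "(P - 1) / u = c * P / Q * (A + B) - c\<^sup>2 * P / Q\<^sup>2 * A * u * B + c / Q / Q * u - (1 + c) / Q"
    by linarith
  then have "P - 1 = (c * P / Q * (A + B) - c\<^sup>2 * P / Q\<^sup>2 * A * u * B + c / Q / Q * u - (1 + c) / Q) * u"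
    using \<open>u > 0\<close> by (metis less_irrefl nonzero_divide_eq_eq)
  then have "1 - P = - ((c * P / Q * (A + B) - c\<^sup>2 * P / Q\<^sup>2 * A * u * B + c / Q / Q * u - (1 + c) / Q) * u)"
    by linarith
  then have "(c\<^sup>2 * P * B * A - c) * (u / Q)\<^sup>2 + (- c * P * (B + A) + c + 1) * (u / Q) = 1 - P"
    by (simp only:) (simp add: power2_eq_square algebra_simps add_divide_distrib diff_divide_distrib)
  then show ?thesis unfolding P_def u_def A_def B_def .
qed

lemma painleve_odd:
  "(c\<^sup>2 * q ^ (2 * n + 1) / Q * y (2 * n) * y (2 * n + 2) - c) * (y (2 * n + 1))\<^sup>2
      + (- c * q ^ (2 * n + 1) * (y (2 * n) + y (2 * n + 2)) + c + 1) * y (2 * n + 1) = 1 - q ^ (2 * n + 1) * Q"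
proof -
  define P u A B where "P = q ^ (2 * n + 1)" and "u = y (2 * n + 1)" and "A = y (2 * n)" and "B = y (2 * n + 2)"
  have "u > 0" unfolding u_def by (intro y_pos) simp
  have "2 * n + 1 - 1 = 2 * n" "2 * n + 1 + 1 = 2 * n + 2" "\<theta> (2 * n + 1) = Q" "\<theta> (2 * n + 2) = 1"
    by (simp_all add: \<theta>_def)
  then have "(P - 1 / Q) / u - c * P / Q * (A + B) + c\<^sup>2 * P / Q\<^sup>2 * A * u * B - c / Q / 1 * u = - ((1 + c) / Q)"
    using first_integral_const[of "2 * n + 1"] unfolding first_integral_def P_def u_def A_def B_def by simp
  then have "(P - 1 / Q) / u = c * P / Q * (A + B) - c\<^sup>2 * P / Q\<^sup>2 * A * u * B + c / Q * u - (1 + c) / Q"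
    by simp
  then have "P - 1 / Q = (c * P / Q * (A + B) - c\<^sup>2 * P / Q\<^sup>2 * A * u * B + c / Q * u - (1 + c) / Q) * u"
    using \<open>u > 0\<close> by (metis less_irrefl nonzero_divide_eq_eq)
  moreover have "1 - P * Q = - Q * (P - 1 / Q)"
    using Q_pos by (simp add: algebra_simps)
  ultimately have "1 - P * Q = - Q * ((c * P / Q * (A + B) - c\<^sup>2 * P / Q\<^sup>2 * A * u * B + c / Q * u - (1 + c) / Q) * u)"
    by simp
  also have "\<dots> = (- c * P * (A + B) + c\<^sup>2 * P / Q * A * u * B - c * u + (1 + c)) * u"
  proof -
    have "Q * (c / Q) = c" "Q * ((1 + c) / Q) = 1 + c" "Q * (c * P / Q * (A + B)) = c * P * (A + B)"
      "Q * (c\<^sup>2 * P / Q\<^sup>2 * A * u * B) = c\<^sup>2 * P / Q * A * u * B"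
      using Q_pos by (simp_all add: power2_eq_square)
    moreover have "- Q * ((r - s + t * u - w) * u) = (- (Q * r) + Q * s - (Q * t) * u + Q * w) * u" for r s t w
      by (simp add: algebra_simps)
    ultimately show ?thesis by (simp only:) simp
  qed
  finally have "1 - P * Q = (- c * P * (A + B) + c\<^sup>2 * P / Q * A * u * B - c * u + (1 + c)) * u" .
  then have "(c\<^sup>2 * P / Q * A * B - c) * u\<^sup>2 + (- c * P * (A + B) + c + 1) * u = 1 - P * Q"
    by (simp only:) (simp add: power2_eq_square algebra_simps)
  then show ?thesis unfolding P_def u_def A_def B_def .
qed

end

section \<open>The functional of the weight\<close>

lemma qpoch_inf_step:
  assumes "a < 1" "0 < r" "r < 1"
  shows "qpoch_inf a r = (1 - a) * qpoch_inf (a * r) r"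
proof -
  have "summable (\<lambda>j. norm ((1 - a * r * r ^ j) - 1))"
    using assms by (auto simp: abs_mult power_abs intro!: summable_mult summable_geometric)
  then have "convergent_prod (\<lambda>j. 1 - a * r * r ^ j)"
    by (intro abs_convergent_prod_imp_convergent_prod summable_imp_abs_convergent_prod)
  then have "(\<lambda>j. 1 - a * r ^ Suc j) has_prod qpoch_inf (a * r) r"
    unfolding qpoch_inf_def using convergent_prod_has_prod by (simp add: mult.assoc)
  then have "(\<lambda>j. 1 - a * r ^ j) has_prod (qpoch_inf (a * r) r * (1 - a * r ^ 0))"
    using has_prod_Suc_iff[of "\<lambda>j. 1 - a * r ^ j"] assms(1) by simp
  then show ?thesis unfolding qpoch_inf_def[of a] by (simp add: has_prod_unique[symmetric] mult.commute)
qed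

context
  fixes q \<alpha> c :: real
  assumes q0: "0 < q" and q1: "q < 1" and al: "\<alpha> > -1" and c0: "c < 0"
begin

text \<open>The mass of the discrete measure at \<open>\<plusminus>q ^ k\<close>, without the factor \<open>1 - q\<close>.\<close>

definition mass :: "nat \<Rightarrow> real" where
  "mass k = weight q \<alpha> c (q ^ k) * q ^ k"

lemma weight_minus: "weight q \<alpha> c (- x) = weight q \<alpha> c x" by (simp add: weight_def)

text \<open>The Pearson equation of the weight on the lattice.\<close>

lemma mass_Suc:
  "(1 - (q ^ Suc k)\<^sup>2) * (1 - c * (q ^ Suc k)\<^sup>2) * mass (Suc k) = q * q powr \<alpha> * mass k"
proof -
  have qq: "0 < q\<^sup>2" "q\<^sup>2 < 1" using q0 q1 by (simp_all add: power_less_one_iff)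
  have e: "(q ^ Suc k)\<^sup>2 = q\<^sup>2 * (q ^ k)\<^sup>2" by (simp add: power_mult_distrib)
  have lt: "(q ^ Suc k)\<^sup>2 < 1" using q0 q1 by (simp add: power_less_one_iff del: power_Suc)
  have "c * (q ^ Suc k)\<^sup>2 < 0" using c0 q0 by (simp add: mult_neg_pos)
  then have "qpoch_inf (q\<^sup>2 * (q ^ k)\<^sup>2) (q\<^sup>2) = (1 - (q ^ Suc k)\<^sup>2) * qpoch_inf (q\<^sup>2 * (q ^ Suc k)\<^sup>2) (q\<^sup>2)"
    "qpoch_inf (c * q\<^sup>2 * (q ^ k)\<^sup>2) (q\<^sup>2) = (1 - c * (q ^ Suc k)\<^sup>2) * qpoch_inf (c * q\<^sup>2 * (q ^ Suc k)\<^sup>2) (q\<^sup>2)"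
    using qpoch_inf_step[OF lt qq] qpoch_inf_step[OF _ qq, of "c * (q ^ Suc k)\<^sup>2"]
    unfolding e by (simp_all add: mult_ac)
  moreover have "\<bar>q ^ Suc k\<bar> powr \<alpha> = q powr \<alpha> * \<bar>q ^ k\<bar> powr \<alpha>"
    using q0 by (simp add: abs_mult powr_mult)
  ultimately show ?thesis unfolding mass_def weight_def by simp
qed

text \<open>The ratio of consecutive masses tends to \<open>q powr (1 + \<alpha>) < 1\<close>; a negative \<open>c\<close> only makes
  it smaller.\<close>

lemma summable_mass: "summable (\<lambda>k. \<bar>mass k\<bar>)"
proof -
  define e where "e = q * q powr \<alpha>"
  have e: "0 < e" "e < 1"
    using q0 q1 al powr_less_mono'[of q 0 "1 + \<alpha>"] by (simp_all add: e_def powr_add)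
  \<comment> \<open>any ratio strictly between the limit \<open>e\<close> of the quotients and \<open>1\<close> will do\<close>
  define d where "d = (1 + e) / 2"
  have d: "0 < d" "e < d" "d < 1" using e by (auto simp: d_def)
  have "(\<lambda>k. (1 - (q ^ Suc k)\<^sup>2)) \<longlonglongrightarrow> 1 - 0\<^sup>2"
    using q0 q1 by (intro tendsto_intros LIMSEQ_Suc LIMSEQ_power_zero) auto
  moreover have "e / d < 1 - 0\<^sup>2" using d by simp
  ultimately have "eventually (\<lambda>k. 1 - (q ^ Suc k)\<^sup>2 > e / d) sequentially"
    by (rule order_tendstoD)
  then obtain N where N: "\<And>k. k \<ge> N \<Longrightarrow> 1 - (q ^ Suc k)\<^sup>2 > e / d" by (auto simp: eventually_sequentially)
  have "\<bar>mass (Suc k)\<bar> \<le> d * \<bar>mass k\<bar>" if "k \<ge> N" for k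
  proof -
    have "c * (q ^ Suc k)\<^sup>2 \<le> 0" using c0 by (simp add: mult_nonpos_nonneg)
    moreover have "0 \<le> 1 - (q ^ Suc k)\<^sup>2"
      using N[OF that] divide_pos_pos[OF e(1) d(1)] by linarith
    ultimately have "e / d * 1 \<le> (1 - (q ^ Suc k)\<^sup>2) * (1 - c * (q ^ Suc k)\<^sup>2)"
      using N[OF that] by (intro mult_mono) simp_all
    then have "e / d * \<bar>mass (Suc k)\<bar> \<le> \<bar>(1 - (q ^ Suc k)\<^sup>2) * (1 - c * (q ^ Suc k)\<^sup>2)\<bar> * \<bar>mass (Suc k)\<bar>"
      by (intro mult_right_mono) auto
    also have "\<dots> = e * \<bar>mass k\<bar>" 
      unfolding abs_mult[symmetric] mass_Suc using e q0 by (simp add: e_def abs_mult)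
    finally show ?thesis using e d by (simp add: field_simps)
  qed
  then show ?thesis using d by (intro summable_ratio_test[of d N]) auto
qed

lemma summable_poly_mass:
  assumes "\<bar>s\<bar> = 1"
  shows "summable (\<lambda>k. poly f (s * q ^ k) * mass k)"
proof -
  have "compact (poly f ` {-1..1})" by (intro compact_continuous_image continuous_intros) auto
  then have "bounded (poly f ` {-1..1})" by (rule compact_imp_bounded)
  then obtain B where B: "\<And>x. x \<in> {-1..1} \<Longrightarrow> \<bar>poly f x\<bar> \<le> B"
    unfolding bounded_iff by (metis image_eqI real_norm_def)
  show ?thesis
  proof (rule summable_comparison_test')
    show "summable (\<lambda>k. B * \<bar>mass k\<bar>)" by (intro summable_mult summable_mass)
    fix k
    have "\<bar>s * q ^ k\<bar> \<le> 1" using assms q0 q1 by (simp add: abs_mult power_le_one)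
    then have "s * q ^ k \<in> {-1..1}" by (simp add: abs_le_iff)
    then show "norm (poly f (s * q ^ k) * mass k) \<le> B * \<bar>mass k\<bar>"
      using B by (auto simp: abs_mult intro!: mult_right_mono)
  qed
qed

definition functional :: "real poly \<Rightarrow> real" where
  "functional f = jackson_integral q (\<lambda>x. poly f x * weight q \<alpha> c x)"

lemma functional_eq:
  "functional f = (1 - q) * ((\<Sum>k. poly f (1 * q ^ k) * mass k) + (\<Sum>k. poly f (- 1 * q ^ k) * mass k))"
  by (simp add: functional_def jackson_integral_def mass_def weight_minus distrib_left mult.assoc)

text \<open>Summation by parts: the quartic vanishes at \<open>\<plusminus>1\<close>, so the sum loses its first term, and the
  shifted sum is again over the whole lattice by the equation for the masses. The two halves of
  the lattice are \<open>s = 1\<close> and \<open>s = -1\<close>.\<close>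

lemma suminf_pearson:
  assumes "\<bar>s\<bar> = 1"
  shows "(\<Sum>k. poly ([:1, 0, - (1 + c), 0, c:] * f) (s * q ^ k) * mass k)
    = q * q powr \<alpha> * (\<Sum>k. poly (f \<circ>\<^sub>p [:0, q:]) (s * q ^ k) * mass k)"
proof -
  have s2: "s\<^sup>2 = 1" using assms by (metis power2_abs one_power2)
  have fac: "poly [:1, 0, - (1 + c), 0, c:] x = (1 - x\<^sup>2) * (1 - c * x\<^sup>2)" for x
    by (simp add: algebra_simps power2_eq_square)
  let ?F = "\<lambda>k. poly ([:1, 0, - (1 + c), 0, c:] * f) (s * q ^ k) * mass k"
  have F_Suc: "?F (Suc k) = q * q powr \<alpha> * (poly (f \<circ>\<^sub>p [:0, q:]) (s * q ^ k) * mass k)" for k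
  proof -
    have "?F (Suc k) = poly f (s * q ^ Suc k) * ((1 - (q ^ Suc k)\<^sup>2) * (1 - c * (q ^ Suc k)\<^sup>2) * mass (Suc k))"
      unfolding poly_mult fac by (simp add: power_mult_distrib s2)
    then show ?thesis unfolding mass_Suc by (simp add: poly_pcompose mult_ac)
  qed
  have "(\<Sum>k. ?F k) = (\<Sum>k. ?F (Suc k)) + ?F 0"
    unfolding suminf_split_head[OF summable_poly_mass[OF assms]] by (simp only: diff_add_cancel)
  also have "?F 0 = 0" unfolding poly_mult fac by (simp add: s2)
  also have "(\<Sum>k. ?F (Suc k)) = q * q powr \<alpha> * (\<Sum>k. poly (f \<circ>\<^sub>p [:0, q:]) (s * q ^ k) * mass k)"
    unfolding F_Suc by (rule suminf_mult[OF summable_poly_mass[OF assms]])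
  finally show ?thesis by simp
qed

lemma semiclassical_functional:
  assumes "orthonormal_polys q \<alpha> c p" "recurrence_coeffs p a"
  shows "semiclassical q (q powr \<alpha>) c functional p a"
proof
  fix f g r
  have sums: "summable (\<lambda>k. poly f (1 * q ^ k) * mass k)" "summable (\<lambda>k. poly f (- 1 * q ^ k) * mass k)" for f
    by (rule summable_poly_mass, simp)+
  show "functional (f + g) = functional f + functional g"
    unfolding functional_eq poly_add distrib_right
      suminf_add[OF sums(1) sums(1), symmetric] suminf_add[OF sums(2) sums(2), symmetric]
    by (simp only: distrib_left add_ac)
  show "functional (smult r f) = r * functional f"
    unfolding functional_eq poly_smult mult.assoc[of r] suminf_mult[OF sums(1)] suminf_mult[OF sums(2)]
    by (simp only: distrib_left mult_ac)
  show "functional ([:1, 0, - (1 + c), 0, c:] * f) = q * q powr \<alpha> * functional (f \<circ>\<^sub>p [:0, q:])"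
    unfolding functional_eq suminf_pearson[of 1, OF abs_one] suminf_pearson[of "-1", OF trans[OF abs_minus_cancel abs_one]]
    by (simp only: distrib_left mult_ac)
  show "functional (p n * p m) = (if m = n then 1 else 0)" for n m
    using assms(1) by (simp add: orthonormal_polys_def functional_def)
  show "lead_coeff (p n) > 0" for n
    using assms(1) unfolding orthonormal_polys_def by blast
qed (use q0 assms in \<open>auto simp: orthonormal_polys_def recurrence_coeffs_def\<close>)

end

section \<open>The operator \<open>T\<close>\<close>

text \<open>Up to scaling, \<open>f_fun\<close> and \<open>g_fun\<close> are both the positive root \<open>r\<close> of \<open>y * r\<^sup>2 + x * r = K\<close>. This
  characterization replaces all computation with the square root.\<close>

definition qroot :: "real \<Rightarrow> real \<Rightarrow> real \<Rightarrow> real" where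
  "qroot K x y = (- x + sqrt (x\<^sup>2 + 4 * K * y)) / (2 * y)"

lemma qroot_eq_iff:
  assumes "K > 0" "y > 0"
  shows "r = qroot K x y \<longleftrightarrow> r > 0 \<and> y * r\<^sup>2 + x * r = K"
proof
  define S where "S = sqrt (x\<^sup>2 + 4 * K * y)"
  have S2: "S\<^sup>2 = x\<^sup>2 + 4 * K * y" unfolding S_def using assms by simp
  have "\<bar>x\<bar> < S" unfolding S_def using assms by (simp add: real_less_rsqrt)
  assume "r = qroot K x y"
  then have r: "2 * y * r = S - x" using assms by (simp add: qroot_def S_def field_simps)
  have "2 * y * r > 0" unfolding r using \<open>\<bar>x\<bar> < S\<close> by linarith
  then have "r > 0" using assms by (simp add: zero_less_mult_iff)
  have "(2 * y * r + x)\<^sup>2 = x\<^sup>2 + 4 * K * y" using r S2 by simp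
  then have "4 * y * (y * r\<^sup>2 + x * r) = 4 * y * K" by (simp add: power2_eq_square algebra_simps)
  then show "r > 0 \<and> y * r\<^sup>2 + x * r = K" using \<open>r > 0\<close> assms by simp
next
  assume r: "r > 0 \<and> y * r\<^sup>2 + x * r = K"
  then have "(2 * y * r + x)\<^sup>2 = x\<^sup>2 + 4 * K * y" by (auto simp: power2_eq_square algebra_simps)
  moreover have "2 * y * r + x > 0"
  proof -
    have "r * (y * r + x) > 0" using r assms by (simp add: power2_eq_square algebra_simps)
    then have "y * r + x > 0" using r by (simp add: zero_less_mult_iff)
    moreover have "y * r > 0" using r assms by simp
    ultimately show ?thesis by linarith
  qed
  ultimately have "sqrt (x\<^sup>2 + 4 * K * y) = 2 * y * r + x" by (metis less_imp_le real_sqrt_unique)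
  then show "r = qroot K x y" using assms by (simp add: qroot_def)
qed

text \<open>The root solves \<open>y * r + x = K / r\<close>, where the left side increases with \<open>x\<close>, \<open>y\<close> and \<open>r\<close> and the
  right side decreases with \<open>r\<close>.\<close>

lemma qroot_antimono:
  assumes "K > 0" "0 < y" "y \<le> y'" "x \<le> x'"
  shows "qroot K x' y' \<le> qroot K x y"
proof (rule ccontr)
  define r r' where "r = qroot K x y" and "r' = qroot K x' y'"
  have r: "r > 0" "y * r\<^sup>2 + x * r = K"
    using qroot_eq_iff[of K y r x] assms by (auto simp: r_def)
  have r': "r' > 0" "y' * r'\<^sup>2 + x' * r' = K"
    using qroot_eq_iff[of K y' r' x'] assms by (auto simp: r'_def)
  assume "\<not> r' \<le> r"
  then have "r < r'" by simp
  have "y * r \<le> y' * r'" using \<open>r < r'\<close> r(1) assms by (intro mult_mono) auto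
  then have "y * r + x \<le> y' * r' + x'" using assms by simp
  moreover have "y * r + x = K / r" "y' * r' + x' = K / r'"
    using r r' by (auto simp: field_simps power2_eq_square)
  moreover have "K / r' < K / r" using \<open>r < r'\<close> r(1) assms by (simp add: divide_strict_left_mono)
  ultimately show False by simp
qed

lemma tendsto_qroot:
  assumes "(X \<longlongrightarrow> x) F" "(Y \<longlongrightarrow> y) F" "y \<noteq> 0"
  shows "((\<lambda>k. qroot K (X k) (Y k)) \<longlongrightarrow> qroot K x y) F"
  unfolding qroot_def using assms by (intro tendsto_intros) auto

context
  fixes q \<alpha> c :: real
  assumes q0: "0 < q" and q1: "q < 1" and al: "\<alpha> > -1" and c0: "c < 0"
begin

abbreviation (input) "T \<equiv> T_op q \<alpha> c"
abbreviation (input) "Q \<equiv> q powr \<alpha>"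

lemma powr_odd:
  "q powr (2 * real n + 1 + \<alpha>) = q ^ (2 * n + 1) * Q"
  "q powr (2 * real n + 1 - \<alpha>) = q ^ (2 * n + 1) / Q"
  using q0 powr_realpow[OF q0, of "2*n"] by (simp_all add: powr_add powr_diff)

lemma K_pos: "n > 0 \<Longrightarrow> 1 - q ^ (2 * n) > 0" "1 - q ^ (2 * n + 1) * Q > 0"
proof -
  show "n > 0 \<Longrightarrow> 1 - q ^ (2 * n) > 0" using q0 q1 by (simp add: power_less_one_iff)
  show "1 - q ^ (2 * n + 1) * Q > 0"
    using q0 q1 al powr_less_mono'[of q 0 "2 * real n + 1 + \<alpha>"] by (simp add: powr_odd)
qed

lemma fst_T: "fst (T z) n = (if n = 0 then 0 else
    Q * qroot (1 - q ^ (2 * n)) (- c * q ^ (2 * n) * (snd z n + snd z (n - 1)) + c + 1)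
                  (c^2 * q ^ (2 * n) * snd z n * snd z (n - 1) - c))"
  by (cases z) (simp add: T_op_def f_fun_def qroot_def powr_minus field_simps)

lemma snd_T: "snd (T z) n =
    qroot (1 - q ^ (2 * n + 1) * Q) (- c * q ^ (2 * n + 1) * (fst z n + fst z (n + 1)) + c + 1)
                  (c^2 * q ^ (2 * n + 1) / Q * fst z n * fst z (n + 1) - c)"
  by (cases z) (simp add: T_op_def g_fun_def qroot_def powr_odd del: power_Suc)

lemma Y_pos:
  assumes "zero_pair \<le> z"
  shows "c^2 * q ^ (2 * n) * snd z n * snd z (n - 1) - c > 0"
    "c^2 * q ^ (2 * n + 1) / Q * fst z n * fst z (n + 1) - c > 0"
proof -
  have "fst z n \<ge> 0" "snd z n \<ge> 0" for n using assms by (auto simp: seq_pair_le_iff zero_pair_def)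
  then have "c^2 * q ^ (2 * n) * snd z n * snd z (n - 1) \<ge> 0"
    "c^2 * q ^ (2 * n + 1) / Q * fst z n * fst z (n + 1) \<ge> 0"
    using q0 by (auto intro!: mult_nonneg_nonneg divide_nonneg_nonneg)
  then show "c^2 * q ^ (2 * n) * snd z n * snd z (n - 1) - c > 0"
    "c^2 * q ^ (2 * n + 1) / Q * fst z n * fst z (n + 1) - c > 0" using c0 by linarith+
qed

text \<open>Since \<open>c < 0\<close>, both arguments of \<open>qroot\<close> increase with the non-negative sequences.\<close>

lemma T_antimono:
  assumes "zero_pair \<le> z" "z \<le> z'"
  shows "T z' \<le> T z"
proof -
  have nn: "fst z n \<ge> 0" "snd z n \<ge> 0" for n using assms by (auto simp: seq_pair_le_iff zero_pair_def)
  have le: "fst z n \<le> fst z' n" "snd z n \<le> snd z' n" for n using assms by (auto simp: seq_pair_le_iff)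
  have nn': "fst z' n \<ge> 0" "snd z' n \<ge> 0" for n using nn le order_trans by blast+
  have X: "- c * q ^ m * (r + s) + c + 1 \<le> - c * q ^ m * (r' + s') + c + 1"
    if "r \<le> r'" "s \<le> s'" for m r s r' s'
    using that c0 q0
    by (intro add_right_mono mult_left_mono) (auto intro: mult_nonpos_nonneg)
  have Y: "k * r * s - c \<le> k * r' * s' - c"
    if "r \<le> r'" "s \<le> s'" "0 \<le> r" "0 \<le> s" "0 \<le> k" for k r s r' s'
    using that by (intro diff_right_mono mult_mono) auto
  have "fst (T z') n \<le> fst (T z) n" for n
  proof (cases "n = 0")
    case False
    have "qroot (1 - q ^ (2 * n)) (- c * q ^ (2 * n) * (snd z' n + snd z' (n - 1)) + c + 1)
            (c^2 * q ^ (2 * n) * snd z' n * snd z' (n - 1) - c)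
        \<le> qroot (1 - q ^ (2 * n)) (- c * q ^ (2 * n) * (snd z n + snd z (n - 1)) + c + 1)
            (c^2 * q ^ (2 * n) * snd z n * snd z (n - 1) - c)"
      using q0 False by (intro qroot_antimono K_pos Y_pos[OF assms(1)] X Y le nn) auto
    then show ?thesis unfolding fst_T using False by (auto intro: mult_left_mono)
  qed (simp add: fst_T)
  moreover have "snd (T z') n \<le> snd (T z) n" for n
    using q0 unfolding snd_T
    by (intro qroot_antimono K_pos Y_pos[OF assms(1)] X Y le nn) auto
  ultimately show ?thesis by (auto simp: seq_pair_le_iff)
qed

text \<open>The coefficient of the square stays above \<open>- c > 0\<close>, so the division is harmless in the limit.\<close>

lemma T_continuous:
  assumes "converges_termwise Z z" "zero_pair \<le> z"
  shows "converges_termwise (\<lambda>k. T (Z k)) (T z)"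
proof -
  have lim: "(\<lambda>k. fst (Z k) n) \<longlonglongrightarrow> fst z n" "(\<lambda>k. snd (Z k) n) \<longlonglongrightarrow> snd z n" for n
    using assms(1) by (auto simp: converges_termwise_def)
  have "(\<lambda>k. fst (T (Z k)) n) \<longlonglongrightarrow> fst (T z) n" for n
    unfolding fst_T using Y_pos(1)[OF assms(2), of n]
    by (cases "n = 0") (auto intro!: tendsto_intros tendsto_qroot lim)
  moreover have "(\<lambda>k. snd (T (Z k)) n) \<longlonglongrightarrow> snd (T z) n" for n
    unfolding snd_T using Y_pos(2)[OF assms(2), of n]
    by (intro tendsto_intros tendsto_qroot lim) auto
  ultimately show ?thesis by (auto simp: converges_termwise_def)
qed

lemma iterate_nonneg: "zero_pair \<le> (T ^^ k) zero_pair"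
  by (induction k) (auto intro!: T_op_nonneg q0 q1 al c0)

text \<open>Everything starts from \<open>0 \<le> T\<^sup>2 0\<close>; each application of the antitone \<open>T\<close> reverses the
  comparison of consecutive iterates of equal parity.\<close>

lemma iterate_le_iterate:
  "(T ^^ (2 * k)) zero_pair \<le> (T ^^ (2 * k + 2)) zero_pair
   \<and> (T ^^ (2 * k + 3)) zero_pair \<le> (T ^^ (2 * k + 1)) zero_pair"
proof -
  have step: "(T ^^ Suc m) zero_pair \<le> (T ^^ Suc l) zero_pair"
    if "(T ^^ l) zero_pair \<le> (T ^^ m) zero_pair" for l m
    using T_antimono[OF iterate_nonneg that] by simp
  show "(T ^^ (2 * k)) zero_pair \<le> (T ^^ (2 * k + 2)) zero_pair
   \<and> (T ^^ (2 * k + 3)) zero_pair \<le> (T ^^ (2 * k + 1)) zero_pair"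
  proof (induction k)
    case 0
    have "(T ^^ 0) zero_pair \<le> (T ^^ 2) zero_pair" using iterate_nonneg[of 2] by simp
    from this step[OF this] show ?case by (simp add: eval_nat_numeral)
  next
    case (Suc k)
    have "(T ^^ Suc (2 * k + 1)) zero_pair \<le> (T ^^ Suc (2 * k + 3)) zero_pair"
      by (rule step) (use Suc in blast)
    from this step[OF this] show ?case by (simp add: eval_nat_numeral)
  qed
qed

lemma incseq_even: "incseq (\<lambda>k. (T ^^ (2 * k)) zero_pair)"
  using iterate_le_iterate by (intro incseq_SucI) simp

lemma decseq_odd: "decseq (\<lambda>k. (T ^^ (2 * k + 1)) zero_pair)"
  using iterate_le_iterate by (intro decseq_SucI) (simp add: eval_nat_numeral)

lemma even_le: "(T ^^ k) zero_pair \<le> T zero_pair" if "even k"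
proof (cases k)
  case (Suc j)
  then show ?thesis using T_antimono[OF order_refl iterate_nonneg[of j]] by simp
qed (use T_op_nonneg[OF q0 q1 al c0 order_refl] in simp)

lemma converges_mono:
  assumes "\<And>n. monoseq (\<lambda>k. fst (Z k) n)" "\<And>n. monoseq (\<lambda>k. snd (Z k) n)"
    and bounds: "\<And>k. zero_pair \<le> Z k" "\<And>k. Z k \<le> b"
  shows "\<exists>z. converges_termwise Z z"
proof -
  have "convergent (\<lambda>k. fst (Z k) n)" "convergent (\<lambda>k. snd (Z k) n)" for n
  proof -
    have "0 \<le> fst (Z k) n" "fst (Z k) n \<le> fst b n" "0 \<le> snd (Z k) n" "snd (Z k) n \<le> snd b n" for k
      using bounds[of k] by (auto simp: seq_pair_le_iff zero_pair_def)
    then have "Bseq (\<lambda>k. fst (Z k) n)" "Bseq (\<lambda>k. snd (Z k) n)"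
      by (auto intro!: BseqI' simp: abs_of_nonneg)
    then show "convergent (\<lambda>k. fst (Z k) n)" "convergent (\<lambda>k. snd (Z k) n)"
      using assms(1,2)[of n] by (auto intro: Bseq_monoseq_convergent)
  qed
  then obtain l m where "\<And>n. (\<lambda>k. fst (Z k) n) \<longlonglongrightarrow> l n" "\<And>n. (\<lambda>k. snd (Z k) n) \<longlonglongrightarrow> m n"
    unfolding convergent_def by metis
  then have "converges_termwise Z (l, m)" by (simp add: converges_termwise_def)
  then show ?thesis ..
qed

lemma converges_termwise_unique:
  assumes "converges_termwise Z z" "converges_termwise Z z'"
  shows "z = z'"
  using assms unfolding converges_termwise_def
  by (auto intro!: prod_eqI ext intro: LIMSEQ_unique)

lemma converges_termwise_le:
  assumes "converges_termwise Z z" "converges_termwise Z' z'" "\<And>k. Z k \<le> Z' k"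
  shows "z \<le> z'"
  using assms unfolding converges_termwise_def seq_pair_le_iff
  by (auto intro!: LIMSEQ_le)

lemma converges_termwise_const: "converges_termwise (\<lambda>k. z) z"
  by (simp add: converges_termwise_def)

text \<open>Continuity turns the alternation of the iterates into a two-cycle of their limits. A fixed
  point lies above \<open>0\<close>, hence, \<open>T\<close> being antitone, above all even and below all odd iterates.\<close>

lemma T_limits:
  "\<exists>z_minus z_plus.
          converges_termwise (\<lambda>k. (T ^^ (2 * k)) zero_pair) z_minus
        \<and> converges_termwise (\<lambda>k. (T ^^ (2 * k + 1)) zero_pair) z_plus
        \<and> T z_minus = z_plus
        \<and> T z_plus = z_minus
        \<and> (\<forall>z. zero_pair \<le> z \<and> T z = z \<longrightarrow> z_minus \<le> z \<and> z \<le> z_plus)"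
proof -
  have "\<exists>z. converges_termwise (\<lambda>k. (T ^^ (2 * k)) zero_pair) z"
    using incseq_even
    by (intro converges_mono[where b = "T zero_pair"] iterate_nonneg even_le)
      (auto simp: incseq_def seq_pair_le_iff intro!: incseq_imp_monoseq)
  then obtain zm where zm: "converges_termwise (\<lambda>k. (T ^^ (2 * k)) zero_pair) zm" ..
  have zm0: "zero_pair \<le> zm"
    by (rule converges_termwise_le[OF converges_termwise_const zm]) (rule iterate_nonneg)
  define zp where "zp = T zm"
  have zp: "converges_termwise (\<lambda>k. (T ^^ (2 * k + 1)) zero_pair) zp"
    using T_continuous[OF zm zm0] by (simp add: zp_def)
  have zp0: "zero_pair \<le> zp"
    by (rule converges_termwise_le[OF converges_termwise_const zp]) (rule iterate_nonneg)
  have "converges_termwise (\<lambda>k. (T ^^ (2 * Suc k)) zero_pair) (T zp)"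
    using T_continuous[OF zp zp0] by simp
  moreover have "converges_termwise (\<lambda>k. (T ^^ (2 * Suc k)) zero_pair) zm"
    using zm unfolding converges_termwise_def by (blast intro: LIMSEQ_Suc[where f = "\<lambda>k. _ ((T ^^ (2 * k)) zero_pair) _"])
  ultimately have Tzp: "T zp = zm" by (rule converges_termwise_unique)
  have "zm \<le> z \<and> z \<le> zp" if z: "zero_pair \<le> z" "T z = z" for z
  proof -
    have "(T ^^ (2 * k)) zero_pair \<le> z \<and> z \<le> (T ^^ (2 * k + 1)) zero_pair" for k
    proof (induction k)
      case 0
      show ?case using T_antimono[OF order_refl z(1)] z by simp
    next
      case (Suc k)
      then have "(T ^^ (2 * Suc k)) zero_pair \<le> z"
        using T_antimono[OF z(1), of "(T ^^ (2 * k + 1)) zero_pair"] z(2) by simp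
      with T_antimono[OF iterate_nonneg this] z(2) show ?case by simp
    qed
    then show ?thesis
      using converges_termwise_le[OF zm converges_termwise_const]
        converges_termwise_le[OF converges_termwise_const zp] by blast
  qed
  then show ?thesis using zm zp zp_def Tzp by blast
qed

end

section \<open>The fixed point and the limits of the iterates\<close>

theorem mainTheorem4:
  fixes q \<alpha> c :: real
    and p :: "nat \<Rightarrow> real poly"
    and a y u v :: "nat \<Rightarrow> real"
  assumes "0 < q" and "q < 1" and "\<alpha> > -1" and "c < 0"
    and "orthonormal_polys q \<alpha> c p"
    and "recurrence_coeffs p a"
    and "y 0 = 0"
    and "\<And>n. n \<ge> 1 \<Longrightarrow> y n = (a n)^2 * q powi (1 - int n)"
    and "\<And>n. u n = y (2 * n)"
    and "\<And>n. v n = y (2 * n + 1)"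
  shows "zero_pair \<le> (u, v) \<and> T_op q \<alpha> c (u, v) = (u, v)
    \<and> incseq (\<lambda>k. (T_op q \<alpha> c ^^ (2 * k)) zero_pair)
    \<and> decseq (\<lambda>k. (T_op q \<alpha> c ^^ (2 * k + 1)) zero_pair)
    \<and> (\<exists>z_minus z_plus.
          converges_termwise (\<lambda>k. (T_op q \<alpha> c ^^ (2 * k)) zero_pair) z_minus
        \<and> converges_termwise (\<lambda>k. (T_op q \<alpha> c ^^ (2 * k + 1)) zero_pair) z_plus
        \<and> T_op q \<alpha> c z_minus = z_plus
        \<and> T_op q \<alpha> c z_plus = z_minus
        \<and> (\<forall>z. zero_pair \<le> z \<and> T_op q \<alpha> c z = z \<longrightarrow> z_minus \<le> z \<and> z \<le> z_plus)
        \<and> (z_minus = z_plus \<longrightarrow> {z. zero_pair \<le> z \<and> T_op q \<alpha> c z = z} = {(u, v)}))"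
proof -
  note q = assms(1-4)
  interpret S: semiclassical q "q powr \<alpha>" c "functional q \<alpha> c" p a
    by (rule semiclassical_functional[OF q assms(5,6)])
  have y: "y = S.y"
  proof
    fix n
    show "y n = S.y n"
    proof (cases n)
      case (Suc m)
      then show ?thesis
        using assms(8)[of n] by (simp add: S.y_def power_int_minus_divide)
    qed (simp add: assms(7) S.y_def)
  qed
  have u: "u n = S.y (2 * n)" and v: "v n = S.y (2 * n + 1)" for n
    using assms(9,10) by (simp_all add: y)
  have y_nonneg: "S.y n \<ge> 0" for n
    using S.y_pos[of n] by (cases n) (auto simp: S.y_def)
  have nonneg: "zero_pair \<le> (u, v)"
    by (simp add: seq_pair_le_iff zero_pair_def u v y_nonneg)
  have "fst (T_op q \<alpha> c (u, v)) n = u n" for n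
  proof (cases "n = 0")
    case False
    then have "2 * (n - 1) + 1 = 2 * n - 1" by simp
    then have v': "v (n - 1) = S.y (2 * n - 1)" by (simp only: v)
    have "u n / q powr \<alpha> = qroot (1 - q ^ (2 * n)) (- c * q ^ (2 * n) * (v n + v (n - 1)) + c + 1)
        (c\<^sup>2 * q ^ (2 * n) * v n * v (n - 1) - c)"
      unfolding qroot_eq_iff[OF K_pos(1)[OF q] Y_pos(1)[OF q nonneg, of n, unfolded snd_conv], OF False[unfolded neq0_conv]]
      using False S.painleve_even[of n] S.y_pos[of "2 * n"] S.Q_pos
      unfolding u[of n] v[of n] v' by simp
    then show ?thesis using False S.Q_pos by (simp add: fst_T[OF q] field_simps)
  qed (simp add: fst_T[OF q] u S.y_def)
  moreover have "snd (T_op q \<alpha> c (u, v)) n = v n" for n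
  proof -
    have "2 * (n + 1) = 2 * n + 2" by simp
    then have u': "u (n + 1) = S.y (2 * n + 2)" by (simp only: u)
    have "v n = qroot (1 - q ^ (2 * n + 1) * q powr \<alpha>) (- c * q ^ (2 * n + 1) * (u n + u (n + 1)) + c + 1)
        (c\<^sup>2 * q ^ (2 * n + 1) / q powr \<alpha> * u n * u (n + 1) - c)"
      using S.painleve_odd[of n] S.y_pos[of "2 * n + 1"]
      by (subst qroot_eq_iff[OF K_pos(2)[OF q] Y_pos(2)[OF q nonneg, of n, unfolded fst_conv]])
         (simp only: u u' v, simp)
    then show ?thesis by (simp only: snd_T[OF q] fst_conv)
  qed
  ultimately have fixed: "T_op q \<alpha> c (u, v) = (u, v)"
    by (intro prod_eqI ext) auto
  obtain zm zp where z:
    "converges_termwise (\<lambda>k. (T_op q \<alpha> c ^^ (2 * k)) zero_pair) zm"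
    "converges_termwise (\<lambda>k. (T_op q \<alpha> c ^^ (2 * k + 1)) zero_pair) zp"
    "T_op q \<alpha> c zm = zp" "T_op q \<alpha> c zp = zm"
    "\<And>z. zero_pair \<le> z \<Longrightarrow> T_op q \<alpha> c z = z \<Longrightarrow> zm \<le> z \<and> z \<le> zp"
    using T_limits[OF q] by blast
  have "{z. zero_pair \<le> z \<and> T_op q \<alpha> c z = z} = {(u, v)}" if "zm = zp"
  proof (intro equalityI subsetI)
    fix w assume "w \<in> {z. zero_pair \<le> z \<and> T_op q \<alpha> c z = z}"
    then have "zp \<le> w" "w \<le> zp" using z(5)[of w] that by simp_all
    moreover have "zp \<le> (u, v)" "(u, v) \<le> zp" using z(5)[OF nonneg fixed] that by simp_all
    ultimately have "w = (u, v)" by (metis order_antisym)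
    then show "w \<in> {(u, v)}" by simp
  next
    fix w assume "w \<in> {(u, v)}"
    then show "w \<in> {z. zero_pair \<le> z \<and> T_op q \<alpha> c z = z}" using nonneg fixed by simp
  qed
  then have unique: "zm = zp \<longrightarrow> {z. zero_pair \<le> z \<and> T_op q \<alpha> c z = z} = {(u, v)}" by (rule impI)
  have "\<forall>z. zero_pair \<le> z \<and> T_op q \<alpha> c z = z \<longrightarrow> zm \<le> z \<and> z \<le> zp"
    using z(5) by simp
  then show ?thesis
    by (intro conjI exI[of _ zm] exI[of _ zp] nonneg fixed incseq_even[OF q] decseq_odd[OF q] z(1-4) unique)
qed

end
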